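(* Let $A\in\mathbb{F}_2[x]$ be bi-unitary perfect with $\omega(A)=3$. Then $A\in\{C_1,\dots,C_7\}$ or $\overline{A}\in\{C_1,\dots,C_7\}$, where $C_1=x^3(x+1)^4M_1$, $C_2=x^3(x+1)^5M_1^2$, $C_3=x^4(x+1)^4M_1^2$, $C_4=x^6(x+1)^6M_1^2$, $C_5=x^4(x+1)^5M_1^3$, $C_6=x^7(x+1)^8M_5$, $C_7=x^7(x+1)^9M_5^2$.
   Context: All polynomials are in $\mathbb{F}_2[x]$. For nonzero $S$, a divisor $D$ of $S$ is unitary if $\gcd(D,S/D)=1$; $\gcd_u(S,T)$ denotes the greatest common unitary divisor of $S$ and $T$. A divisor $D$ of $S$ is bi-unitary if $\gcd_u(D,S/D)=1$. $\sigma^{**}(S)$ denotes the sum of all bi-unitary divisors of $S$, and $S$ is bi-unitary perfect if $\sigma^{**}(S)=S$. $\omega(S)$ is the number of distinct irreducible factors of $S$. For $S\in\mathbb{F}_2[x]$, $\overline{S}(x)=S(x+1)$. $M_1=1+x+x^2$, $M_4=1+x+x^2+x^3+x^4$, $M_5=1+x^3+x^4$. *)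

theory Defs
  imports "HOL-Library.Z2" "HOL-Computational_Algebra.Computational_Algebra"
    "HOL-Computational_Algebra.Field_as_Ring"
begin

text \<open>
  The field with two elements is the type \<^typ>\<open>bit\<close>. The library provides gcds and prime
  factorisations of polynomials over fields of class \<^class>\<open>field_gcd\<close> only, so the trivial
  Euclidean structure of a field is installed on \<^typ>\<open>bit\<close>.
\<close>

instantiation bit ::
  "{unique_euclidean_ring, normalization_euclidean_semiring, normalization_semidom_multiplicative}"
begin

definition [simp]: "normalize_bit = (normalize_field :: bit \<Rightarrow> _)"
definition [simp]: "unit_factor_bit = (unit_factor_field :: bit \<Rightarrow> _)"
definition [simp]: "euclidean_size_bit = (euclidean_size_field :: bit \<Rightarrow> _)"
definition [simp]: "division_segment (x :: bit) = 1"

instance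
proof
  fix a b :: bit
  show "euclidean_size (a mod b) < euclidean_size b" if "b \<noteq> 0"
    using that by (cases a; cases b) simp_all
qed (simp_all add: dvd_field_iff split: if_splits
    del: add_bit_eq_xor mult_bit_eq_and bit_not_zero_iff bit_not_one_iff modulo_bit_unfold
      divide_bit_def)

end

instantiation bit :: euclidean_ring_gcd
begin

definition gcd_bit :: "bit \<Rightarrow> bit \<Rightarrow> bit" where
  "gcd_bit = Euclidean_Algorithm.gcd"
definition lcm_bit :: "bit \<Rightarrow> bit \<Rightarrow> bit" where
  "lcm_bit = Euclidean_Algorithm.lcm"
definition Gcd_bit :: "bit set \<Rightarrow> bit" where
  "Gcd_bit = Euclidean_Algorithm.Gcd"
definition Lcm_bit :: "bit set \<Rightarrow> bit" where
  "Lcm_bit = Euclidean_Algorithm.Lcm"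

instance
  by standard (simp_all add: gcd_bit_def lcm_bit_def Gcd_bit_def Lcm_bit_def)

end

instance bit :: field_gcd ..

definition unitary_divisor :: "bit poly \<Rightarrow> bit poly \<Rightarrow> bool" where
  "unitary_divisor D S \<longleftrightarrow> D dvd S \<and> gcd D (S div D) = 1"

text \<open>
  ``Greatest'' refers to the degree. For nonzero arguments the common unitary divisors are closed
  under lcm, so the maximiser is unique.
\<close>

definition gcd_u :: "bit poly \<Rightarrow> bit poly \<Rightarrow> bit poly" where
  "gcd_u S T = (ARG_MAX degree D. unitary_divisor D S \<and> unitary_divisor D T)"

definition biunitary_divisor :: "bit poly \<Rightarrow> bit poly \<Rightarrow> bool" where
  "biunitary_divisor D S \<longleftrightarrow> D dvd S \<and> gcd_u D (S div D) = 1"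

definition sigma_bu :: "bit poly \<Rightarrow> bit poly" where
  "sigma_bu S = (\<Sum>D | biunitary_divisor D S. D)"

definition biunitary_perfect :: "bit poly \<Rightarrow> bool" where
  "biunitary_perfect S \<longleftrightarrow> S \<noteq> 0 \<and> sigma_bu S = S"

definition omega :: "bit poly \<Rightarrow> nat" where
  "omega S = card (prime_factors S)"

definition conj_poly :: "bit poly \<Rightarrow> bit poly" where
  "conj_poly S = pcompose S [:1, 1:]"

abbreviation X :: "bit poly" where
  "X \<equiv> [:0, 1:]"

definition M1 :: "bit poly" where
  "M1 = 1 + X + X ^ 2"

definition M5 :: "bit poly" where
  "M5 = 1 + X ^ 3 + X ^ 4"

definition C1 :: "bit poly" where "C1 = X ^ 3 * (X + 1) ^ 4 * M1"
definition C2 :: "bit poly" where "C2 = X ^ 3 * (X + 1) ^ 5 * M1 ^ 2"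
definition C3 :: "bit poly" where "C3 = X ^ 4 * (X + 1) ^ 4 * M1 ^ 2"
definition C4 :: "bit poly" where "C4 = X ^ 6 * (X + 1) ^ 6 * M1 ^ 2"
definition C5 :: "bit poly" where "C5 = X ^ 4 * (X + 1) ^ 5 * M1 ^ 3"
definition C6 :: "bit poly" where "C6 = X ^ 7 * (X + 1) ^ 8 * M5"
definition C7 :: "bit poly" where "C7 = X ^ 7 * (X + 1) ^ 9 * M5 ^ 2"

lemma is_unit_bit_poly_iff: "is_unit (D :: bit poly) \<longleftrightarrow> D = 1"
proof
  assume "is_unit D"
  then obtain c where "D = [:c:]" "c \<noteq> 0"
    by (metis is_unit_polyE dvd_0_left_iff zero_neq_one)
  then show "D = 1"
    by (metis bit_not_zero_iff one_pCons)
qed simp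

lemma gcd_u_eq_1_iff:
  assumes "S \<noteq> 0"
  shows "gcd_u S T = 1 \<longleftrightarrow> (\<forall>D. unitary_divisor D S \<and> unitary_divisor D T \<longrightarrow> D = 1)"
proof -
  define P where "P = (\<lambda>D. unitary_divisor D S \<and> unitary_divisor D T)"
  have P1: "P 1"
    by (simp add: P_def unitary_divisor_def)
  have "\<forall>D. P D \<longrightarrow> degree D < Suc (degree S)"
    unfolding P_def unitary_divisor_def less_Suc_eq_le using assms dvd_imp_degree_le by blast
  from arg_max_nat_lemma[OF P1 this]
  have G: "P (gcd_u S T)" "\<And>D. P D \<Longrightarrow> degree D \<le> degree (gcd_u S T)"
    unfolding gcd_u_def P_def by blast+
  have "D = 1" if "gcd_u S T = 1" "P D" for D
  proof -
    have "degree D = 0"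
      using G(2)[OF that(2)] that(1) by simp
    moreover have "D \<noteq> 0"
      using that(2) assms unfolding P_def unitary_divisor_def by (metis dvd_0_left)
    ultimately show ?thesis
      by (metis is_unit_iff_degree is_unit_bit_poly_iff)
  qed
  with G(1) show ?thesis
    unfolding P_def by blast
qed

end

theory Submission
  imports Defs
begin

text \<open>
  \<open>\<sigma>**\<close> is multiplicative, and \<open>\<sigma>**(p\<^sup>a)\<close> is a product of a power of \<open>1 + p\<close> and of sums
  \<open>geo p u = 1 + p + \<cdots> + p\<^bsup>u-1\<^esup>\<close> with \<open>u\<close> odd; it is always divisible by \<open>1 + p\<close>. Hence \<open>x\<close> and
  \<open>x + 1\<close> divide \<open>A\<close>, and the third prime \<open>P\<close> satisfies \<open>1 + P = x\<^sup>i (x + 1)\<^sup>j\<close>. For odd \<open>u\<close>,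
  \<open>geo p u\<close> vanishes neither at 0 nor at 1. So \<open>geo P u = 1\<close>, and for linear \<open>L\<close> the squarefree
  polynomial \<open>geo L u\<close> is 1 or \<open>P\<close>. In the latter case \<open>u = 2\<^sup>k + 1\<close>, and irreducibility forces
  \<open>k \<le> 2\<close>. Comparing the exponents of \<open>x\<close>, \<open>x + 1\<close>, \<open>P\<close> on both sides of \<open>\<sigma>**(A) = A\<close> leaves
  the listed polynomials.
\<close>

section \<open>Polynomial arithmetic in characteristic two\<close>

lemma bit_poly_add_self: "p + p = (0 :: bit poly)"
proof (rule poly_eqI)
  show "coeff (p + p) n = coeff 0 n" for n
    unfolding coeff_add by (cases "coeff p n") auto
qed

lemma bit_poly_uminus: "- p = (p :: bit poly)"
  using bit_poly_add_self[of p] by (metis minus_unique)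

lemma bit_poly_minus: "p - q = p + (q :: bit poly)"
  by (metis bit_poly_uminus diff_conv_add_uminus)

lemma normalize_bit_poly: "normalize p = (p :: bit poly)"
proof (cases "p = 0")
  case False
  have "unit_factor p = 1"
    using unit_factor_is_unit[OF False] is_unit_bit_poly_iff by blast
  then show ?thesis
    by (metis mult_1 unit_factor_mult_normalize)
qed simp

section \<open>Bi-unitary divisors and multiplicativity of their sum\<close>

text \<open>If \<open>D\<close> and \<open>E = S div D\<close> contain \<open>p\<close> to the same
  power, that power is a common unitary divisor. Conversely, a unitary divisor contains each of its
  primes to the full power, so a prime of a common unitary divisor has equal multiplicity in
  \<open>D\<close> and \<open>E\<close>.\<close>

lemma biunitary_divisor_iff:
  assumes "S \<noteq> 0"
  shows "biunitary_divisor D S \<longleftrightarrow>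
    D dvd S \<and> (\<forall>p. prime p \<and> p dvd S \<longrightarrow> 2 * multiplicity p D \<noteq> multiplicity p S)"
proof (cases "D dvd S")
  case True
  then obtain E where S: "S = D * E" by blast
  with assms have D0: "D \<noteq> 0" and E0: "E \<noteq> 0" by auto
  have mult: "multiplicity p S = multiplicity p D + multiplicity p E" if "prime p" for p
    using prime_elem_multiplicity_mult_distrib[of p D E] that D0 E0 S by auto
  have unitary: "unitary_divisor (p ^ multiplicity p F) F" if "prime p" "F \<noteq> 0" for p F :: "bit poly"
  proof -
    have "\<not> is_unit p" using that by auto
    from multiplicity_decompose'[OF that(2) this] obtain G
      where G: "F = p ^ multiplicity p F * G" "\<not> p dvd G" by blast
    have "coprime (p ^ multiplicity p F) G"
      using G(2) that(1) by (simp add: prime_imp_coprime coprime_power_left_iff)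
    moreover have "F div p ^ multiplicity p F = G"
      using G(1) that(1) by (metis nonzero_mult_div_cancel_left power_not_zero not_prime_0)
    ultimately show ?thesis
      unfolding unitary_divisor_def using G(1) by (metis coprime_imp_gcd_eq_1 dvd_triv_left)
  qed
  have mult_unitary: "multiplicity p F = multiplicity p G"
    if "prime p" "p dvd F" "unitary_divisor F G" "G \<noteq> 0" for p F G
  proof -
    from that(3) obtain H where H: "G = F * H" unfolding unitary_divisor_def by blast
    with that(4) have nz: "F \<noteq> 0" "H \<noteq> 0" by auto
    have "coprime F H"
      using that(3) H nz unfolding unitary_divisor_def by (simp add: coprime_iff_gcd_eq_1)
    hence "\<not> p dvd H"
      using that(1,2) by (meson coprime_common_divisor not_prime_unit)
    thus ?thesis
      using H nz that(1) by (simp add: prime_elem_multiplicity_mult_distrib not_dvd_imp_multiplicity_0)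
  qed
  have "gcd_u D E = 1 \<longleftrightarrow> (\<forall>p. prime p \<and> p dvd S \<longrightarrow> 2 * multiplicity p D \<noteq> multiplicity p S)"
  proof (intro iffI allI impI notI)
    fix p assume *: "gcd_u D E = 1" "prime p \<and> p dvd S" "2 * multiplicity p D = multiplicity p S"
    have eq: "multiplicity p E = multiplicity p D" using mult[of p] * by simp
    have "p ^ multiplicity p D = 1"
      using *(1,2) unitary[of p D] unitary[of p E] D0 E0 eq gcd_u_eq_1_iff[OF D0, of E] by metis
    hence "multiplicity p D = 0"
      using *(2) by (metis is_unit_power_iff dvd_refl not_prime_unit)
    with *(3) have "multiplicity p S = 0" by simp
    with *(2) assms show False
      by (metis multiplicity_eq_zero_iff not_prime_unit)
  next
    assume *: "\<forall>p. prime p \<and> p dvd S \<longrightarrow> 2 * multiplicity p D \<noteq> multiplicity p S"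
    show "gcd_u D E = 1"
      unfolding gcd_u_eq_1_iff[OF D0]
    proof (intro allI impI, rule ccontr)
      fix F assume F: "unitary_divisor F D \<and> unitary_divisor F E" "F \<noteq> 1"
      have "F \<noteq> 0" using F D0 unfolding unitary_divisor_def by (metis dvd_0_left)
      moreover have "\<not> is_unit F" using F is_unit_bit_poly_iff by blast
      ultimately obtain p where p: "prime p" "p dvd F" using prime_divisor_exists by blast
      have "multiplicity p D = multiplicity p E"
        using mult_unitary[OF p] F D0 E0 by metis
      hence "2 * multiplicity p D = multiplicity p S" using mult p by simp
      moreover have "p dvd S" using p F S unfolding unitary_divisor_def by (meson dvd_mult2 dvd_trans)
      ultimately show False using * p by blast
    qed
  qed
  moreover have "S div D = E" using S D0 by simp
  ultimately show ?thesis using True unfolding biunitary_divisor_def by simp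
qed (simp add: biunitary_divisor_def)

text \<open>The multiplicity criterion is local at each prime, and a prime of \<open>S * T\<close>
  sees only one of the two coprime factors.\<close>

lemma biunitary_divisor_mult_iff:
  assumes "coprime S T" "S \<noteq> 0" "T \<noteq> 0" "D dvd S" "E dvd T"
  shows "biunitary_divisor (D * E) (S * T) \<longleftrightarrow> biunitary_divisor D S \<and> biunitary_divisor E T"
proof -
  have aux: "multiplicity p (F * G) = multiplicity p F"
    if "prime p" "p dvd U" "coprime U V" "F \<noteq> 0" "G \<noteq> 0" "G dvd V" for p F G U V :: "bit poly"
  proof -
    have "\<not> p dvd G" using that by (meson coprime_common_divisor dvd_trans not_prime_unit)
    thus ?thesis
      using that by (simp add: prime_elem_multiplicity_mult_distrib not_dvd_imp_multiplicity_0)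
  qed
  have nz: "D \<noteq> 0" "E \<noteq> 0" "S * T \<noteq> 0" using assms by auto
  have 1: "multiplicity p (D * E) = multiplicity p D" "multiplicity p (S * T) = multiplicity p S"
    if "prime p" "p dvd S" for p
    using aux[OF that assms(1)] nz assms by auto
  have 2: "multiplicity p (D * E) = multiplicity p E" "multiplicity p (S * T) = multiplicity p T"
    if "prime p" "p dvd T" for p
    using aux[OF that, of S E D] aux[OF that, of S T S] nz assms
    by (auto simp: mult.commute coprime_commute)
  show ?thesis
    unfolding biunitary_divisor_iff[OF nz(3)] biunitary_divisor_iff[OF assms(2)]
      biunitary_divisor_iff[OF assms(3)]
    using assms(4,5) 1 2 by (auto simp: mult_dvd_mono prime_dvd_mult_iff)
qed

text \<open>Pairs of bi-unitary divisors correspond bijectively to those of the product: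
  \<open>D\<close> is recovered from \<open>D * E\<close> as its gcd with \<open>S\<close>.\<close>

lemma sigma_bu_mult:
  assumes "coprime S T" "S \<noteq> 0" "T \<noteq> 0"
  shows "sigma_bu (S * T) = sigma_bu S * sigma_bu T"
proof -
  let ?B = "\<lambda>S. {D. biunitary_divisor D S}"
  have dvdD: "D dvd S" if "biunitary_divisor D S" for D S
    using that by (simp add: biunitary_divisor_def)
  have gcdD: "gcd (D * E) S = D" if "D dvd S" "E dvd T" "coprime S T" for D E S T :: "bit poly"
  proof -
    have "coprime S E" using that by (meson coprime_divisors dvd_refl)
    hence "gcd (D * E) S = gcd D S" by (metis gcd_mult_right_right_cancel gcd.commute)
    thus ?thesis using that(1) by (simp add: gcd_proj1_if_dvd normalize_bit_poly)
  qed
  have "inj_on (\<lambda>(D, E). D * E) (?B S \<times> ?B T)"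
  proof (rule inj_onI, clarify)
    fix D E D' E' assume *: "biunitary_divisor D S" "biunitary_divisor E T"
      "biunitary_divisor D' S" "biunitary_divisor E' T" "D * E = D' * E'"
    note d = *(1-4)[THEN dvdD]
    have "D = D'" using gcdD[of D S E T] gcdD[of D' S E' T] d * assms(1) by metis
    moreover have "D \<noteq> 0" using d assms by auto
    ultimately show "D = D' \<and> E = E'" using *(5) by simp
  qed
  moreover have "?B (S * T) = (\<lambda>(D, E). D * E) ` (?B S \<times> ?B T)"
  proof (intro equalityI subsetI)
    fix F assume "F \<in> ?B (S * T)"
    hence F: "biunitary_divisor F (S * T)" by simp
    obtain D E where "F = D * E" "D dvd S" "E dvd T" using division_decomp[OF dvdD[OF F]] by blast
    thus "F \<in> (\<lambda>(D, E). D * E) ` (?B S \<times> ?B T)"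
      using F biunitary_divisor_mult_iff[OF assms] by auto
  qed (use biunitary_divisor_mult_iff[OF assms] dvdD in auto)
  ultimately have "sigma_bu (S * T) = (\<Sum>(D, E)\<in>?B S \<times> ?B T. D * E)"
    unfolding sigma_bu_def by (simp add: sum.reindex case_prod_unfold)
  thus ?thesis
    unfolding sigma_bu_def by (simp add: sum_product sum.cartesian_product)
qed

lemma sigma_bu_prime_power:
  assumes "prime p" "a > 0"
  shows "sigma_bu (p ^ a) = (\<Sum>i | i \<le> a \<and> 2 * i \<noteq> a. p ^ i)"
proof -
  have nu: "\<not> is_unit p" "p \<noteq> 0" using assms(1) by auto
  have mult: "multiplicity p (p ^ i) = i" for i
    using nu by (simp add: multiplicity_same_power)
  have "biunitary_divisor (p ^ i) (p ^ a) \<longleftrightarrow> i \<le> a \<and> 2 * i \<noteq> a" for i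
  proof -
    have "q = p" if "prime q" "q dvd p ^ a" for q
      using that assms(1) by (meson prime_dvd_power primes_dvd_imp_eq)
    thus ?thesis
      using assms mult nu by (auto simp: biunitary_divisor_iff dvd_power_iff)
  qed
  moreover have "\<exists>i. D = p ^ i" if "biunitary_divisor D (p ^ a)" for D
    using that divides_primepow[OF assms(1), of D a]
    by (metis biunitary_divisor_def normalize_bit_poly)
  ultimately have "{D. biunitary_divisor D (p ^ a)} = (\<lambda>i. p ^ i) ` {i. i \<le> a \<and> 2 * i \<noteq> a}"
    by blast
  moreover have "inj_on (\<lambda>i. p ^ i) {i. i \<le> a \<and> 2 * i \<noteq> a}"
    using mult by (metis inj_onI)
  ultimately show ?thesis unfolding sigma_bu_def by (simp add: sum.reindex)
qed

section \<open>Geometric sums and the Frobenius map\<close>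

definition geo :: "bit poly \<Rightarrow> nat \<Rightarrow> bit poly" where
  "geo p n = (\<Sum>i<n. p ^ i)"

lemma geo_0 [simp]: "geo p 0 = 0" and geo_1 [simp]: "geo p (Suc 0) = 1"
  by (simp_all add: geo_def)

lemma geo_Suc: "geo p (Suc n) = 1 + p * geo p n"
  unfolding geo_def sum.lessThan_Suc_shift by (simp add: sum_distrib_left)

lemma one_plus_geo_Suc: "1 + geo p (Suc n) = p * geo p n"
  unfolding geo_Suc using bit_poly_add_self[of 1] by (simp only: add.assoc[symmetric] add_0)

lemma one_plus_mult_geo: "(1 + p) * geo p n = 1 + p ^ n"
  using one_diff_power_eq[of p n] unfolding geo_def bit_poly_minus by (rule sym)

lemma bit_poly_add_square: "(p + q)\<^sup>2 = p\<^sup>2 + (q :: bit poly)\<^sup>2"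
  using bit_poly_add_self[of "p * q"] by (simp add: power2_eq_square algebra_simps)

lemma bit_poly_add_power_two_power: "(p + q) ^ 2 ^ s = p ^ 2 ^ s + (q :: bit poly) ^ 2 ^ s"
proof (induction s)
  case (Suc s)
  have "r ^ 2 ^ Suc s = (r ^ 2 ^ s)\<^sup>2" for r :: "bit poly"
    by (simp add: power_mult[symmetric] mult.commute)
  then show ?case
    by (simp only: Suc bit_poly_add_square)
qed simp

lemma bit_poly_sum_square: "(\<Sum>i\<in>I. f i :: bit poly)\<^sup>2 = (\<Sum>i\<in>I. (f i)\<^sup>2)"
  by (induction I rule: infinite_finite_induct) (simp_all add: bit_poly_add_square)

lemma bit_poly_telescope: "(\<Sum>i<k. f (Suc i)) + (\<Sum>i<k. f i) = f k + (f 0 :: bit poly)"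
  using sum_lessThan_telescope[of f k] by (simp add: sum_subtractf bit_poly_minus sum.distrib)

text \<open>By Frobenius, \<open>1 + p ^ (2 ^ s * u)\<close> is the \<open>2 ^ s\<close>-th power of
  \<open>1 + p ^ u\<close>. Both are multiples of \<open>1 + p\<close> by geometric sums, and one
  factor \<open>1 + p\<close> cancels.\<close>

lemma geo_two_power_mult:
  assumes "p \<noteq> 1"
  shows "geo p (2 ^ s * u) = (1 + p) ^ (2 ^ s - 1) * geo p u ^ 2 ^ s"
proof -
  have nz: "1 + p \<noteq> 0"
    using assms bit_poly_minus[of 1 p] by (metis eq_iff_diff_eq_0)
  have "(1 + p) * geo p (2 ^ s * u) = (1 + p ^ u) ^ 2 ^ s"
    by (simp add: one_plus_mult_geo bit_poly_add_power_two_power power_mult[symmetric] mult.commute)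
  also have "\<dots> = (1 + p) ^ Suc (2 ^ s - 1) * geo p u ^ 2 ^ s"
    by (simp add: power_mult_distrib flip: one_plus_mult_geo)
  finally have "(1 + p) * geo p (2 ^ s * u) = (1 + p) * ((1 + p) ^ (2 ^ s - 1) * geo p u ^ 2 ^ s)"
    by (simp only: power_Suc mult.assoc)
  then show ?thesis
    using nz by (simp only: mult_cancel_left simp_thms)
qed

lemma geo_two_power: "p \<noteq> 1 \<Longrightarrow> geo p (2 ^ s) = (1 + p) ^ (2 ^ s - 1)"
  using geo_two_power_mult[of p s 1] by simp

section \<open>Bi-unitary divisor sums of prime powers\<close>

lemma sigma_bu_odd_power:
  assumes "prime p" "odd a"
  shows "sigma_bu (p ^ a) = geo p (Suc a)"
proof -
  have "{i. i \<le> a \<and> 2 * i \<noteq> a} = {..<Suc a}"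
    using assms(2) by auto
  then show ?thesis
    using sigma_bu_prime_power[OF assms(1), of a] assms(2) by (simp add: geo_def odd_pos)
qed

text \<open>Omitting the middle term \<open>p ^ n\<close> leaves \<open>geo p n\<close> and its
  multiple by \<open>p ^ Suc n\<close>; the common factor \<open>1 + p ^ Suc n\<close> is
  \<open>(1 + p) * geo p (Suc n)\<close>.\<close>

lemma sigma_bu_even_power:
  assumes "prime p" "n > 0"
  shows "sigma_bu (p ^ (2 * n)) = (1 + p) * geo p n * geo p (Suc n)"
proof -
  have "{i. i \<le> 2 * n \<and> 2 * i \<noteq> 2 * n} = {..<n} \<union> {0 + Suc n..<n + Suc n}"
    by auto
  then have "sigma_bu (p ^ (2 * n)) = (\<Sum>i\<in>{..<n} \<union> {0 + Suc n..<n + Suc n}. p ^ i)"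
    using sigma_bu_prime_power[OF assms(1), of "2 * n"] assms(2) by simp
  also have "\<dots> = geo p n + (\<Sum>i = 0 + Suc n..<n + Suc n. p ^ i)"
    unfolding geo_def by (rule sum.union_disjoint) auto
  also have "(\<Sum>i = 0 + Suc n..<n + Suc n. p ^ i) = p ^ Suc n * geo p n"
    unfolding sum.shift_bounds_nat_ivl geo_def
    by (simp add: sum_distrib_left power_add atLeast0LessThan mult_ac)
  also have "geo p n + p ^ Suc n * geo p n = (1 + p ^ Suc n) * geo p n"
    by (simp add: algebra_simps)
  also have "\<dots> = (1 + p) * geo p n * geo p (Suc n)"
    unfolding one_plus_mult_geo[symmetric] by (simp add: mult_ac)
  finally show ?thesis .
qed

lemma prime_neq_1: "prime (p :: bit poly) \<Longrightarrow> p \<noteq> 1"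
  by auto

text \<open>For even exponents the factor is explicit. For odd ones the sum has even length, and
  \<open>geo_two_power_mult\<close> with \<open>s = 1\<close> extracts it.\<close>

lemma one_plus_dvd_sigma_bu:
  assumes "prime p" "a > 0"
  shows "1 + p dvd sigma_bu (p ^ a)"
proof (cases "even a")
  case True
  then obtain n where "a = 2 * n" by blast
  then show ?thesis
    using assms sigma_bu_even_power[of p n] by (simp add: mult.assoc)
next
  case False
  then obtain n where "Suc a = 2 ^ 1 * n"
    by (metis even_Suc dvdE power_one_right)
  then show ?thesis
    using sigma_bu_odd_power[OF assms(1) False] geo_two_power_mult[OF prime_neq_1, of p 1 n] assms
    by simp
qed

section \<open>Odd-length geometric sums and linear polynomials\<close>

text \<open>With \<open>n = 2 * m + 1\<close> the sum is \<open>1 + p * geo p (2 * m)\<close>. At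
  \<open>x\<close> either \<open>p\<close> vanishes, or \<open>p\<close> has value 1 and the even
  number of equal terms cancels.\<close>

lemma poly_geo_odd:
  assumes "odd n"
  shows "poly (geo p n) x = 1"
proof -
  obtain m where n: "n = Suc (2 * m)" using assms by (auto elim: oddE)
  have "poly (geo p (2 * m)) x = 0 \<or> poly p x = 0"
  proof (cases "poly p x = 0")
    case False
    then have "p \<noteq> 1 \<longrightarrow> poly (1 + p) x = 0" by auto
    \<comment> \<open>The constant \<open>p = 1\<close> is treated apart because
      \<open>geo_two_power_mult\<close> cancels \<open>1 + p\<close>.\<close>
    moreover have "geo 1 (2 * m) = 0"
      unfolding geo_def using bit_poly_add_self[of 1] by simp
    moreover have "p \<noteq> 1 \<longrightarrow> geo p (2 * m) = (1 + p) * geo p m ^ 2"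
      using geo_two_power_mult[of p 1 m] by simp
    ultimately show ?thesis by (cases "p = 1") auto
  qed simp
  then show ?thesis
    unfolding n geo_Suc by auto
qed

lemma linear_dvd_iff: "[:r, 1:] dvd p \<longleftrightarrow> poly p (r :: bit) = 0"
  using poly_eq_0_iff_dvd[of p r] by (cases r) simp_all

lemma prime_linear: "prime [:r :: bit, 1:]"
proof -
  have "prime_elem [:r, 1:]"
    by (rule prime_elemI) (auto simp: linear_dvd_iff is_unit_bit_poly_iff one_pCons)
  then show ?thesis
    by (simp add: prime_def normalize_bit_poly)
qed

lemma coprime_geo_odd:
  assumes "odd n"
  shows "coprime (geo p n) (X ^ i * (X + 1) ^ j)"
proof -
  have "coprime (geo p n) [:r, 1:]" for r
    using prime_imp_coprime[OF prime_linear, of r "geo p n"] assms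
    by (simp add: linear_dvd_iff poly_geo_odd coprime_commute)
  from this[of 0] this[of 1] show ?thesis
    by (simp add: coprime_power_right_iff one_pCons)
qed

lemma degree_geo_linear:
  assumes "n > 0"
  shows "Suc (degree (geo [:r, 1:] n)) = n"
proof -
  have eq: "degree (1 + [:r, 1:] ^ n) = n"
    using assms by (simp add: degree_add_eq_right degree_linear_power)
  have "geo [:r, 1:] n \<noteq> 0"
    using eq assms one_plus_mult_geo[of "[:r, 1:]" n] by auto
  moreover have "1 + [:r, 1:] = [:1 + r, 1:]"
    by (simp add: one_pCons)
  ultimately have "degree ((1 + [:r, 1:]) * geo [:r, 1:] n) = Suc (degree (geo [:r, 1:] n))"
    by (subst degree_mult_eq) auto
  then show ?thesis
    by (simp only: one_plus_mult_geo eq)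
qed

lemma geo_linear_eq_1_iff: "n > 0 \<Longrightarrow> geo [:r, 1:] n = 1 \<longleftrightarrow> n = 1"
  using degree_geo_linear[of n r] by auto

text \<open>Since \<open>u\<close> is odd, \<open>1 + L ^ u\<close> has derivative
  \<open>L ^ (u - 1)\<close>. A repeated prime factor would divide both \<open>L ^ u\<close> and
  \<open>1 + L ^ u\<close>, hence 1.\<close>

lemma geo_linear_squarefree:
  assumes "prime P" "odd u" "geo [:r, 1:] u dvd P ^ m"
  shows "geo [:r, 1:] u = 1 \<or> geo [:r, 1:] u = P"
proof -
  let ?L = "[:r, 1:]"
  obtain j where j: "geo ?L u = P ^ j"
    using divides_primepow[OF assms(1,3)] by (metis normalize_bit_poly)
  have "\<not> 2 \<le> j"
  proof
    assume "2 \<le> j"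
    then have "P\<^sup>2 dvd geo ?L u" unfolding j by (rule le_imp_power_dvd)
    then have "P\<^sup>2 dvd 1 + ?L ^ u"
      by (metis dvd_mult one_plus_mult_geo)
    then obtain Q where Q: "1 + ?L ^ u = P * (P * Q)"
      by (metis dvdE power2_eq_square mult.assoc)
    have "of_nat u = (1 :: bit)"
      using assms(2) by (auto elim!: oddE)
    then have "pderiv (1 + ?L ^ u) = ?L ^ (u - 1)"
      using assms(2) by (simp add: pderiv_add pderiv_power pderiv_pCons odd_pos)
    moreover have "P dvd pderiv (P * (P * Q))"
      unfolding pderiv_mult by (metis dvd_add dvd_mult dvd_mult2 dvd_triv_left)
    ultimately have "P dvd ?L ^ (u - 1)"
      unfolding Q by simp
    then have "P dvd ?L ^ u"
      using assms(2) by (metis dvd_mult odd_pos power_minus_mult dvd_mult2)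
    moreover have "P dvd 1 + ?L ^ u" unfolding Q by simp
    ultimately have "P dvd 1" by (metis dvd_add_left_iff)
    then show False using assms(1) by auto
  qed
  then have "j = 0 \<or> j = 1" by auto
  then show ?thesis using j by auto
qed

section \<open>Reducibility of geometric sums of length \<open>2 ^ k + 1\<close>\<close>

lemma coeff_X_power: "coeff (X ^ n) m = (if m = n then 1 else 0)"
  using coeff_monom[of "1 :: bit" n m] by (simp add: monom_altdef)

text \<open>
  Modulo \<open>x\<^sup>N + 1\<close> with \<open>N = 2\<^sup>k + 1\<close> the polynomial \<open>R\<close> below is the trace
  \<open>x + x\<^sup>2 + x\<^sup>4 + \<cdots>\<close> (\<open>2k\<close> terms), so \<open>R\<^sup>2 = R\<close> there. A prime \<open>P = 1 + x + \<cdots> + x\<^bsup>N-1\<^esup>\<close>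
  would divide \<open>R\<close> or \<open>R + 1\<close>. By degree one of them would be a constant multiple of \<open>P\<close>, but
  their coefficients at \<open>x\<close> and \<open>x\<^sup>3\<close> differ.
\<close>

lemma not_prime_geo_X:
  assumes "k \<ge> 3"
  shows "\<not> prime (geo X (2 ^ k + 1))"
proof
  define N :: nat where "N = 2 ^ k + 1"
  define P where "P = geo X N"
  define R where "R = (\<Sum>i<k. X ^ 2 ^ i) + (\<Sum>i<k. X ^ (N - 2 ^ i))"
  assume "prime (geo X (2 ^ k + 1))"
  then have primeP: "prime P" by (simp add: P_def N_def)
  have P: "(1 + X) * P = 1 + X ^ N"
    by (simp only: P_def one_plus_mult_geo)
  have pow_less: "2 * 2 ^ i \<le> (2::nat) ^ k" if "i < k" for i
    using that power_increasing[of "Suc i" k "2::nat"] by simp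
  have "R\<^sup>2 = (\<Sum>i<k. X ^ 2 ^ Suc i) + (\<Sum>i<k. (X ^ (N - 2 ^ i))\<^sup>2)"
    unfolding R_def bit_poly_add_square bit_poly_sum_square
    by (simp add: power_mult[symmetric] mult.commute)
  \<comment> \<open>Squaring turns the exponent \<open>N - 2 ^ i\<close> into
    \<open>N + (N - 2 ^ Suc i)\<close>; splitting off a multiple of \<open>1 + X ^ N\<close> reduces
    it again.\<close>
  also have "(\<Sum>i<k. (X ^ (N - 2 ^ i))\<^sup>2) =
      (\<Sum>i<k. (1 + X ^ N) * X ^ (N - 2 ^ Suc i) + X ^ (N - 2 ^ Suc i))"
  proof (rule sum.cong)
    fix i assume "i \<in> {..<k}"
    then have "(N - 2 ^ i) * 2 = N + (N - 2 ^ Suc i)"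
      using pow_less[of i] by (simp add: N_def)
    then have "(X ^ (N - 2 ^ i))\<^sup>2 = X ^ N * X ^ (N - 2 ^ Suc i)"
      by (metis power_mult power_add)
    moreover have "(1 + p) * q + q = p * q" for p q :: "bit poly"
    proof -
      have "(1 + p) * q + q = p * q + (q + q)" by (simp only: distrib_right mult_1 add_ac)
      then show ?thesis by (simp only: bit_poly_add_self add_0_right)
    qed
    ultimately show "(X ^ (N - 2 ^ i))\<^sup>2 = (1 + X ^ N) * X ^ (N - 2 ^ Suc i) + X ^ (N - 2 ^ Suc i)"
      by metis
  qed simp
  also have "\<dots> = (1 + X ^ N) * (\<Sum>i<k. X ^ (N - 2 ^ Suc i)) + (\<Sum>i<k. X ^ (N - 2 ^ Suc i))"
    by (simp only: sum.distrib sum_distrib_left)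
  finally have "R\<^sup>2 + R = (1 + X ^ N) * (\<Sum>i<k. X ^ (N - 2 ^ Suc i))
      + ((\<Sum>i<k. X ^ 2 ^ Suc i) + (\<Sum>i<k. X ^ 2 ^ i))
      + ((\<Sum>i<k. X ^ (N - 2 ^ Suc i)) + (\<Sum>i<k. X ^ (N - 2 ^ i)))"
    by (simp only: R_def add_ac)
  also have "\<dots> = (1 + X ^ N) * (\<Sum>i<k. X ^ (N - 2 ^ Suc i))
      + (X ^ 2 ^ k + X ^ 2 ^ 0) + (X ^ (N - 2 ^ k) + X ^ (N - 2 ^ 0))"
    unfolding bit_poly_telescope[of "\<lambda>i. X ^ 2 ^ i"] bit_poly_telescope[of "\<lambda>i. X ^ (N - 2 ^ i)"] ..
  \<comment> \<open>Since \<open>N - 2 ^ k = 1\<close> and \<open>N - 2 ^ 0 = 2 ^ k\<close>, the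
    ends of the two telescoping sums agree and cancel.\<close>
  also have "\<dots> = (1 + X ^ N) * (\<Sum>i<k. X ^ (N - 2 ^ Suc i)) + ((X ^ 2 ^ k + X) + (X ^ 2 ^ k + X))"
    by (simp only: N_def power_0 power_one_right add_diff_cancel_left' add_diff_cancel_right' add_ac)
  also have "\<dots> = (1 + X) * P * (\<Sum>i<k. X ^ (N - 2 ^ Suc i))"
    unfolding P by (simp only: bit_poly_add_self add_0_right)
  finally have "P dvd R\<^sup>2 + R" by simp
  then have "P dvd R * (R + 1)" by (simp add: power2_eq_square algebra_simps)
  then have "P dvd R \<or> P dvd R + 1" using primeP by (simp add: prime_dvd_mult_iff)
  then obtain c where dvd: "P dvd R + [:c:]"
    by (metis add_0_right pCons_0_0 one_pCons)
  have "1 = (2::nat) ^ i \<longleftrightarrow> i = 0" for i by (cases i) auto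
  moreover have "1 \<noteq> N - 2 ^ i" if "i < k" for i
  proof -
    have "(1::nat) \<le> 2 ^ i" by simp
    then show ?thesis using pow_less[OF that] unfolding N_def by linarith
  qed
  ultimately have "coeff R 1 = (\<Sum>i<k. if i = 0 then 1 else 0)"
    unfolding R_def coeff_add coeff_sum coeff_X_power by simp
  then have R1: "coeff R 1 = 1" using assms by simp
  have "3 \<noteq> (2::nat) ^ i" for i by (cases i) (simp_all, presburger)
  \<comment> \<open>This is where \<open>k \<ge> 3\<close> matters: for \<open>k = 2\<close> the
    exponent \<open>N - 2\<close> equals 3.\<close>
  moreover have "3 \<noteq> N - 2 ^ i" if "i < k" for i
  proof -
    have "(8::nat) \<le> 2 ^ k" using power_increasing[OF assms, of "2::nat"] by simp
    then show ?thesis using pow_less[OF that] unfolding N_def by linarith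
  qed
  ultimately have R3: "coeff R 3 = 0"
    unfolding R_def coeff_add coeff_sum coeff_X_power by simp
  have "N - 2 ^ i \<le> 2 ^ k" for i
    using one_le_power[of "2::nat" i] unfolding N_def by linarith
  then have "degree R \<le> 2 ^ k"
    unfolding R_def
    by (intro degree_add_le degree_sum_le) (auto simp: degree_linear_power)
  then have deg: "degree (R + [:c:]) \<le> 2 ^ k"
    by (intro degree_add_le) auto
  have degP: "degree P = 2 ^ k"
    using degree_geo_linear[of N 0] by (simp add: P_def N_def)
  have coeffP: "coeff P j = 1" if "j < N" for j
    using that unfolding P_def geo_def coeff_sum coeff_X_power by simp
  obtain Q where Q: "R + [:c:] = P * Q" using dvd by blast
  have c1: "coeff (R + [:c:]) 1 = 1" and c3: "coeff (R + [:c:]) 3 = 0"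
    using R1 R3 by (simp_all add: coeff_pCons numeral_3_eq_3)
  then have "P * Q \<noteq> 0" unfolding Q by auto
  then have "degree Q = 0"
    using deg degP unfolding Q by (auto simp: degree_mult_eq)
  then obtain q where q: "Q = [:q:]" by (rule degree_eq_zeroE)
  have "1 < N" "3 < N" using power_increasing[OF assms, of "2::nat"] by (simp_all add: N_def)
  then have "coeff (P * Q) 1 = coeff (P * Q) 3"
    unfolding q by (simp add: coeffP)
  then show False using c1 c3 unfolding Q by simp
qed

section \<open>The substitution of x + 1 for x\<close>

lemma conj_poly_mult: "conj_poly (p * q) = conj_poly p * conj_poly q"
  and conj_poly_sum: "conj_poly (sum f I) = (\<Sum>i\<in>I. conj_poly (f i))"
  and conj_poly_linear: "conj_poly [:r, 1:] = [:r + 1, 1:]"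
  by (simp_all add: conj_poly_def pcompose_mult pcompose_sum pcompose_pCons)

lemma conj_poly_power: "conj_poly (p ^ n) = conj_poly p ^ n"
  by (induction n) (simp_all add: conj_poly_def pcompose_1 pcompose_mult)

lemma conj_poly_involution: "conj_poly (conj_poly p) = p"
proof -
  have "[:1 :: bit, 1:] \<circ>\<^sub>p [:1, 1:] = [:0, 1:]" by (simp add: pcompose_pCons)
  then show ?thesis unfolding conj_poly_def pcompose_assoc[symmetric] by simp
qed

lemma conj_poly_geo_linear: "conj_poly (geo [:r, 1:] n) = geo [:r + 1, 1:] n"
  by (simp only: geo_def conj_poly_sum conj_poly_power conj_poly_linear)

lemma prime_conj_poly:
  assumes "prime p"
  shows "prime (conj_poly p)"
proof -
  have dvd: "conj_poly p dvd q \<longleftrightarrow> p dvd conj_poly q" for q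
    by (metis conj_poly_involution conj_poly_mult dvd_def)
  have one: "conj_poly 1 = 1" by (simp add: conj_poly_def pcompose_1)
  have "conj_poly p \<noteq> 0"
    using assms by (metis conj_poly_def conj_poly_involution not_prime_0 pcompose_0)
  then have "prime_elem (conj_poly p)"
    by (intro prime_elemI) (use assms in \<open>auto simp: dvd one conj_poly_mult prime_dvd_mult_iff\<close>)
  then show ?thesis by (simp add: prime_def normalize_bit_poly)
qed

section \<open>Shape of the prime-power sums that can occur\<close>

lemma two_power_decompose:
  fixes n :: nat
  assumes "n > 0"
  obtains s u where "n = 2 ^ s * u" "odd u"
proof -
  have "n \<noteq> 0" "\<not> is_unit (2 :: nat)" using assms by auto
  from multiplicity_decompose'[OF this] show thesis using that by metis
qed

text \<open>Write \<open>u - 1 = 2 ^ k * w\<close> with \<open>w\<close> odd. Then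
  \<open>1 + geo L u = L * geo L (u - 1)\<close> is divisible by \<open>geo L w\<close>, which is
  coprime to x and x + 1. So \<open>w = 1\<close>, and \<open>not_prime_geo_X\<close> bounds
  \<open>k\<close>.\<close>

lemma prime_geo_linear_mersenne:
  assumes "prime (geo [:r, 1:] u)" "odd u" "1 + geo [:r, 1:] u dvd X ^ i * (X + 1) ^ j"
  shows "u = 3 \<or> u = 5"
proof -
  let ?L = "[:r, 1:]"
  have u1: "u \<noteq> 1" using assms(1) by auto
  then have "u - 1 > 0" using assms(2) by (cases u) auto
  from two_power_decompose[OF this] obtain k w where w: "u = Suc (2 ^ k * w)" "odd w"
    using assms(2) by (metis Suc_pred' odd_pos)
  have "1 + geo ?L u = ?L * geo ?L (2 ^ k * w)"
    unfolding w(1) by (rule one_plus_geo_Suc)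
  also have "\<dots> = ?L * ((1 + ?L) ^ (2 ^ k - 1) * geo ?L w ^ 2 ^ k)"
    by (subst geo_two_power_mult) (auto simp: one_pCons)
  finally have "geo ?L w dvd 1 + geo ?L u"
    by (metis dvd_mult dvd_power pos2 zero_less_power)
  then have "geo ?L w dvd X ^ i * (X + 1) ^ j" using assms(3) dvd_trans by blast
  then have "is_unit (geo ?L w)"
    using coprime_geo_odd[OF w(2), of ?L i j] by (metis coprime_common_divisor dvd_refl)
  then have "w = 1"
    using w(2) by (simp add: is_unit_bit_poly_iff geo_linear_eq_1_iff odd_pos)
  then have u: "u = 2 ^ k + 1" using w by simp
  \<comment> \<open>Conjugation carries the case \<open>L = X + 1\<close> to
    \<open>L = X\<close>.\<close>
  have "prime (geo X u)"
    using assms(1) prime_conj_poly[OF assms(1)] unfolding conj_poly_geo_linear by (cases r) auto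
  then have "k < 3" using not_prime_geo_X u by (metis not_le_imp_less)
  then have "k = 0 \<or> k = 1 \<or> k = 2" by auto
  then show ?thesis using u assms(2) by auto
qed

text \<open>An odd-length factor \<open>geo P u\<close> is coprime to x, x + 1 and \<open>P\<close>,
  hence equals 1, so \<open>P ^ u = P\<close> and \<open>u = 1\<close>. For \<open>c = 2 * n\<close>
  one of \<open>n\<close> and \<open>n + 1\<close> is odd, which leaves
  \<open>n = 1\<close>.\<close>

lemma sigma_bu_mersenne_prime_power:
  assumes "prime P" "c > 0" "sigma_bu (P ^ c) dvd X ^ i * (X + 1) ^ j * P ^ m"
  shows "(c = 2 \<or> (\<exists>s. c = 2 ^ s - 1)) \<and> sigma_bu (P ^ c) = (1 + P) ^ c"
proof -
  have P1: "P \<noteq> 1" using assms(1) by auto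
  have key: "u = 1" if "odd u" "geo P u dvd sigma_bu (P ^ c)" for u
  proof -
    from that(1) obtain v where v: "u = Suc v" by (cases u) auto
    have "\<not> P dvd geo P u"
      unfolding v geo_Suc using assms(1) by (metis dvd_add_left_iff dvd_triv_left not_prime_unit)
    then have "coprime (geo P u) (P ^ m)"
      using assms(1) by (simp add: coprime_commute prime_imp_coprime)
    then have "coprime (geo P u) (X ^ i * (X + 1) ^ j * P ^ m)"
      using coprime_geo_odd[OF that(1)] by simp
    moreover have "geo P u dvd X ^ i * (X + 1) ^ j * P ^ m"
      using that(2) assms(3) dvd_trans by blast
    ultimately have "geo P u = 1"
      by (metis coprime_common_divisor dvd_refl is_unit_bit_poly_iff)
    then have "P ^ u = P ^ 1"
      using one_plus_mult_geo[of P u] by simp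
    then show ?thesis
      using assms(1) by (metis multiplicity_same_power not_prime_0 not_prime_unit)
  qed
  show ?thesis
  proof (cases "even c")
    case False
    obtain s u where u: "Suc c = 2 ^ s * u" "odd u"
      using two_power_decompose[of "Suc c"] by auto
    have sig: "sigma_bu (P ^ c) = (1 + P) ^ (2 ^ s - 1) * geo P u ^ 2 ^ s"
      using sigma_bu_odd_power[OF assms(1) False] u(1) geo_two_power_mult[OF P1] by simp
    have "u = 1"
      by (rule key[OF u(2)]) (simp add: sig dvd_mult dvd_power)
    then have "c = 2 ^ s - 1" using u(1) by simp
    then show ?thesis using sig \<open>u = 1\<close> by auto
  next
    case True
    then obtain n where n: "c = 2 * n" by blast
    with assms(2) have "n > 0" by simp
    note sig = sigma_bu_even_power[OF assms(1) this, folded n]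
    have "n = 1"
    proof (cases "even n")
      case True
      then have "Suc n = 1" by (intro key) (simp_all add: sig)
      then show ?thesis using \<open>n > 0\<close> by simp
    next
      case False
      then show ?thesis by (intro key) (simp_all add: sig)
    qed
    then show ?thesis using sig n by (simp add: geo_Suc power2_eq_square)
  qed
qed

text \<open>An odd-length factor \<open>geo L u\<close> is 1 or \<open>P\<close>, so
  \<open>u\<close> is 1, 3 or 5; \<open>d\<close> is the degree of \<open>P\<close>. For
  \<open>a = 2 * n\<close> the odd length is \<open>n + 1\<close> when \<open>a = 2 * d\<close>, and
  \<open>n = 3\<close> when \<open>a = 6\<close>.\<close>

lemma sigma_bu_linear_power:
  assumes "prime P" "a > 0" "sigma_bu ([:r, 1:] ^ a) dvd X ^ i * (X + 1) ^ j * P ^ m"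
    and "1 + P dvd X ^ i' * (X + 1) ^ j'"
  defines "L \<equiv> [:r, 1:]"
  shows "(a = 2 \<or> (\<exists>s. a = 2 ^ s - 1)) \<and> sigma_bu (L ^ a) = (1 + L) ^ a \<or>
    (\<exists>d. d \<in> {2, 4} \<and> P = geo L (Suc d) \<and>
      ((\<exists>s>0. a = 2 ^ s * Suc d - 1 \<and> sigma_bu (L ^ a) = (1 + L) ^ (2 ^ s - 1) * P ^ 2 ^ s) \<or>
       a = 2 * d \<and> sigma_bu (L ^ a) = (1 + L) ^ d * P \<or>
       d = 2 \<and> a = 6 \<and> sigma_bu (L ^ a) = (1 + L) ^ 4 * P))"
proof -
  have primeL: "prime L" unfolding L_def by (rule prime_linear)
  have L1: "L \<noteq> 1" using primeL by auto
  have key: "u = 1 \<or> u = 3 \<and> P = geo L 3 \<or> u = 5 \<and> P = geo L 5"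
    if u: "odd u" "geo L u dvd sigma_bu (L ^ a)" for u
  proof -
    have "geo L u dvd X ^ i * (X + 1) ^ j * P ^ m"
      using u(2) assms(3) dvd_trans unfolding L_def by blast
    then have "geo L u dvd P ^ m"
      using coprime_geo_odd[OF u(1)] by (simp add: coprime_dvd_mult_right_iff)
    then consider "geo L u = 1" | "geo L u = P"
      using geo_linear_squarefree[OF assms(1) u(1)] unfolding L_def by blast
    then show ?thesis
    proof cases
      case 1
      then show ?thesis using u(1) geo_linear_eq_1_iff[of u r] unfolding L_def by (simp add: odd_pos)
    next
      case 2
      then have "u = 3 \<or> u = 5"
        using prime_geo_linear_mersenne[of r u i' j'] assms(1,4) u(1) unfolding L_def by simp
      then show ?thesis using 2 by auto
    qed
  qed
  have inj: "m = n" if "geo L m = geo L n" "m > 0" "n > 0" for m n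
    using that degree_geo_linear unfolding L_def by metis
  have geo2: "geo L 2 = 1 + L" and geo4: "geo L 4 = (1 + L) ^ 3"
    using geo_two_power[OF L1, of 1] geo_two_power[OF L1, of 2] by simp_all
  show ?thesis
  proof (cases "even a")
    case False
    obtain s u where u: "Suc a = 2 ^ s * u" "odd u"
      using two_power_decompose[of "Suc a"] by auto
    have sig: "sigma_bu (L ^ a) = (1 + L) ^ (2 ^ s - 1) * geo L u ^ 2 ^ s"
      using sigma_bu_odd_power[OF primeL False] u(1) geo_two_power_mult[OF L1] by simp
    have s: "s > 0" using u False by (cases s) auto
    have a: "a = 2 ^ s * u - 1" using u(1) by simp
    have "geo L u dvd sigma_bu (L ^ a)" by (simp add: sig dvd_mult dvd_power)
    from key[OF u(2) this] consider "u = 1" | d where "d \<in> {2, 4}" "u = Suc d" "P = geo L (Suc d)"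
      by force
    then show ?thesis
    proof cases
      case 1
      then show ?thesis using a sig by auto
    next
      case 2
      then show ?thesis using a sig s by blast
    qed
  next
    case True
    then obtain n where n: "a = 2 * n" by blast
    with assms(2) have npos: "n > 0" by simp
    note sig = sigma_bu_even_power[OF primeL npos, folded n]
    show ?thesis
    proof (cases "even n")
      case True
      have "Suc n = 1 \<or> Suc n = 3 \<and> P = geo L 3 \<or> Suc n = 5 \<and> P = geo L 5"
        by (rule key) (simp_all add: sig True)
      then have nd: "n = 2 \<or> n = 4" "P = geo L (Suc n)" using npos by auto
      \<comment> \<open>Here \<open>n\<close> is a power of two, so \<open>geo L n\<close> is a
        power of \<open>1 + L\<close>.\<close>
      have "(1 + L) * geo L n = (1 + L) ^ n"
        using nd(1) geo2 geo4 by (auto simp: power2_eq_square power_numeral_reduce)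
      then show ?thesis using sig nd n by auto
    next
      case False
      have "n = 1 \<or> n = 3 \<and> P = geo L 3 \<or> n = 5 \<and> P = geo L 5"
        by (rule key) (simp_all add: sig False)
      then consider "n = 1" | "n = 3" "P = geo L 3" | "n = 5" "P = geo L 5" by blast
      then show ?thesis
      proof cases
        case 1
        then show ?thesis using sig n geo2 by (simp add: power2_eq_square numeral_2_eq_2)
      next
        case 2
        then have "sigma_bu (L ^ a) = (1 + L) ^ 4 * P"
          using sig geo4 by (simp add: power_numeral_reduce mult_ac)
        then show ?thesis by (intro disjI2 exI[of _ 2]) (use 2 n in auto)
      next
        case 3
        \<comment> \<open>The even length 6 brings in the odd length 3, so \<open>geo L 3\<close>
          and \<open>geo L 5\<close> would both equal \<open>P\<close>, against their
          degrees.\<close>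
        have "geo L 6 = (1 + L) * geo L 3 ^ 2"
          using geo_two_power_mult[OF L1, of 1 3] by simp
        then have "geo L 3 dvd sigma_bu (L ^ a)"
          using sig 3(1) by simp
        from key[OF _ this] have "geo L 5 = geo L 3"
          using 3(2) by auto
        then show ?thesis using inj[of 5 3] by simp
      qed
    qed
  qed
qed

section \<open>Comparison of exponents\<close>

lemma prime_powers_eq_imp:
  fixes p q r :: "bit poly"
  assumes "prime p" "prime q" "prime r" "p \<noteq> q" "p \<noteq> r" "q \<noteq> r"
    and "p ^ i * q ^ j * r ^ k = p ^ i' * q ^ j' * r ^ k'"
  shows "i = i' \<and> j = j' \<and> k = k'"
proof -
  have *: "multiplicity s (p ^ i * q ^ j * r ^ k) =
      (if s = p then i else if s = q then j else if s = r then k else 0)"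
    if "prime s" for s i j k
    using that assms(1-6)
    by (auto simp: prime_elem_multiplicity_mult_distrib prime_elem_multiplicity_power_distrib
        prime_multiplicity_other)
  have "(if s = p then i else if s = q then j else if s = r then k else 0) =
    (if s = p then i' else if s = q then j' else if s = r then k' else 0)" if "prime s" for s
    using arg_cong[OF assms(7), of "multiplicity s"] unfolding *[OF that] .
  from this[OF assms(1)] this[OF assms(2)] this[OF assms(3)] show ?thesis
    using assms(4-6) by auto
qed

lemma geo_linear_explicit:
  "geo X 3 = [:1, 1, 1:]" "geo [:1, 1:] 3 = [:1, 1, 1:]"
  "geo X 5 = [:1, 1, 1, 1, 1:]" "geo [:1, 1:] 5 = [:1, 0, 0, 1, 1:]"
  by (simp_all add: eval_nat_numeral geo_Suc one_pCons)

lemma M1_explicit: "M1 = [:1, 1, 1:]" and M5_explicit: "M5 = [:1, 0, 0, 1, 1:]"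
  by (simp_all add: M1_def M5_def eval_nat_numeral one_pCons)

lemma one_plus_M1: "1 + M1 = X * (X + 1)"
  and one_plus_geo_X_5: "1 + geo X 5 = X * (X + 1) ^ 3"
  and one_plus_geo_X1_5: "1 + geo [:1, 1:] 5 = X ^ 3 * (X + 1)"
  unfolding M1_explicit geo_linear_explicit by (simp_all add: eval_nat_numeral one_pCons)

text \<open>
  The possible values of \<open>a\<close>, \<open>e\<close>, \<open>f\<close> in \<open>\<sigma>**(L\<^sup>a) = (1 + L)\<^sup>e P\<^sup>f\<close> for a linear factor \<open>L\<close>, where
  \<open>t\<close> says whether \<open>P = 1 + L + \<cdots> + L\<^sup>d\<close>. The powers of two that occur are relaxed to parity
  conditions (and \<open>a \<noteq> 5\<close>), which still determine the solutions and leave a linear problem.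
\<close>

definition linear_exps :: "nat \<Rightarrow> bool \<Rightarrow> nat \<Rightarrow> nat \<Rightarrow> nat \<Rightarrow> bool" where
  "linear_exps d t a e f \<longleftrightarrow> f = 0 \<and> e = a \<and> (a = 2 \<or> odd a \<and> a \<noteq> 5) \<or>
     t \<and> ((\<exists>y>0. even y \<and> a = y * Suc d - 1 \<and> e = y - 1 \<and> f = y) \<or>
       a = 2 * d \<and> e = d \<and> f = 1 \<or> d = 2 \<and> a = 6 \<and> e = 4 \<and> f = 1)"

text \<open>Only the alternatives guarded by \<open>t\<close> depend on \<open>d\<close>. So
  \<open>d\<close> can be set to a common value once \<open>P\<close> is known.\<close>

lemma linear_exps_mono: "linear_exps d t a e f \<Longrightarrow> (t \<Longrightarrow> d = d' \<and> t') \<Longrightarrow> linear_exps d' t' a e f"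
  by (cases t) (simp_all add: linear_exps_def)

text \<open>The case \<open>P = M1\<close>: both linear factors may produce \<open>P\<close>, and 1
  + P = x(x + 1) contributes \<open>c\<close> to each of their exponents.\<close>

lemma linear_exps_2_solutions:
  assumes "linear_exps 2 True a ea fa" "linear_exps 2 True b eb fb" "c > 0" "c = 2 \<or> odd c"
    "a = eb + c" "b = ea + c" "c = fa + fb"
  shows "(a, b, c) \<in>
      {(3, 4, 1), (4, 3, 1), (3, 5, 2), (5, 3, 2), (4, 4, 2), (6, 6, 2), (4, 5, 3), (5, 4, 3)}"
  using assms unfolding linear_exps_def by (elim disjE conjE exE; force?; (simp, presburger)?)

text \<open>The case \<open>P = geo L 5\<close>, with \<open>a\<close> the exponent of
  \<open>L\<close> and \<open>b\<close> that of \<open>1 + L\<close>. Only \<open>L\<close> can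
  produce \<open>P\<close>, and \<open>1 + P = L * (1 + L) ^ 3\<close>.\<close>

lemma linear_exps_4_solutions:
  assumes "linear_exps 4 True a ea fa" "linear_exps 4 False b b 0" "c > 0" "c = 2 \<or> odd c"
    "a = b + c" "b = ea + 3 * c" "c = fa"
  shows "(a, b, c) \<in> {(8, 7, 1), (9, 7, 2)}"
  using assms unfolding linear_exps_def by auto

lemma linear_exps_of_sigma_bu:
  assumes "prime P" "a > 0" "sigma_bu ([:r, 1:] ^ a) dvd X ^ i * (X + 1) ^ j * P ^ m"
    and "1 + P dvd X ^ i' * (X + 1) ^ j'"
  obtains d e f where "d \<in> {2, 4}" "linear_exps d (P = geo [:r, 1:] (Suc d)) a e f"
    "sigma_bu ([:r, 1:] ^ a) = (1 + [:r, 1:]) ^ e * P ^ f"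
proof -
  let ?L = "[:r, 1:]"
  have odd: "odd (2 ^ s - 1 :: nat) \<and> 2 ^ s - 1 \<noteq> (5 :: nat)" if "2 ^ s - 1 > (0 :: nat)" for s
  proof -
    have "s \<noteq> 0" using that by (cases s) auto
    moreover have "(2::nat) ^ s \<noteq> 6"
    proof
      assume s: "(2::nat) ^ s = 6"
      then have "s < 3" using power_increasing[of 3 s "2::nat"] by (cases "s < 3") auto
      then have "s = 0 \<or> s = 1 \<or> s = 2" by auto
      with s show False by auto
    qed
    ultimately show ?thesis by auto
  qed
  from sigma_bu_linear_power[OF assms] show thesis
  proof (elim disjE exE conjE)
    assume *: "a = 2" "sigma_bu (?L ^ a) = (1 + ?L) ^ a"
    \<comment> \<open>With \<open>f = 0\<close> any \<open>d\<close> fits; 2 is a default.\<close>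
    show thesis by (rule that[of 2 a 0]) (use * in \<open>auto simp: linear_exps_def\<close>)
  next
    fix s assume *: "a = 2 ^ s - 1" "sigma_bu (?L ^ a) = (1 + ?L) ^ a"
    have "odd a \<and> a \<noteq> 5" using odd[of s] *(1) assms(2) by simp
    then have "linear_exps 2 (P = geo ?L (Suc 2)) a a 0" unfolding linear_exps_def by simp
    then show thesis by (rule that[rotated]) (simp_all add: *(2))
  next
    fix d s :: nat assume *: "d \<in> {2, 4}" "P = geo ?L (Suc d)" "s > 0" "a = 2 ^ s * Suc d - 1"
      "sigma_bu (?L ^ a) = (1 + ?L) ^ (2 ^ s - 1) * P ^ 2 ^ s"
    have "even ((2::nat) ^ s)" "(2::nat) ^ s > 0" using *(3) by auto
    then have "linear_exps d (P = geo ?L (Suc d)) a (2 ^ s - 1) (2 ^ s)"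
      unfolding linear_exps_def using *(2,4) by blast
    then show thesis by (rule that[OF *(1) _ *(5)])
  next
    fix d assume *: "d \<in> {2, 4}" "P = geo ?L (Suc d)" "a = 2 * d"
      "sigma_bu (?L ^ a) = (1 + ?L) ^ d * P"
    have "linear_exps d (P = geo ?L (Suc d)) a d 1" unfolding linear_exps_def using *(2,3) by blast
    then show thesis by (rule that[OF *(1)]) (simp add: *(4))
  next
    fix d :: nat assume *: "d \<in> {2, 4}" "P = geo ?L (Suc d)" "d = 2" "a = 6"
      "sigma_bu (?L ^ a) = (1 + ?L) ^ 4 * P"
    have "linear_exps d (P = geo ?L (Suc d)) a 4 1" unfolding linear_exps_def using *(2-4) by blast
    then show thesis by (rule that[OF *(1)]) (simp add: *(5))
  qed
qed

section \<open>Prime factors of a bi-unitary perfect polynomial and the classification\<close>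

lemma biunitary_perfect_one_plus_dvd:
  assumes "biunitary_perfect A" "prime p" "p dvd A"
  shows "1 + p dvd A"
proof -
  have A: "A \<noteq> 0" "sigma_bu A = A" using assms(1) by (auto simp: biunitary_perfect_def)
  have nu: "\<not> is_unit p" using assms(2) by auto
  from multiplicity_decompose'[OF A(1) nu] obtain B
    where B: "A = p ^ multiplicity p A * B" "\<not> p dvd B" by blast
  define m where "m = multiplicity p A"
  have m: "m > 0" using assms(3) A(1) nu unfolding m_def by (simp add: multiplicity_gt_zero_iff)
  have "coprime (p ^ m) B" using B(2) assms(2) by (simp add: prime_imp_coprime)
  moreover have "B \<noteq> 0" "p ^ m \<noteq> 0" using A B assms(2) by auto
  ultimately have "sigma_bu A = sigma_bu (p ^ m) * sigma_bu B"
    using sigma_bu_mult B(1) unfolding m_def by metis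
  then show ?thesis using one_plus_dvd_sigma_bu[OF assms(2) m] A(2) by (metis dvd_mult2)
qed

text \<open>A prime \<open>p\<close> other than x has constant term 1, so x divides
  \<open>1 + p\<close>, which divides \<open>A\<close>. Then x + 1 divides \<open>A\<close> by the
  same principle applied to x.\<close>

lemma biunitary_perfect_linear_factors:
  assumes "biunitary_perfect A" "omega A \<noteq> 0"
  shows "X dvd A" "X + 1 dvd A"
proof -
  show X: "X dvd A"
  proof (rule ccontr)
    assume "\<not> X dvd A"
    obtain p where p: "prime p" "p dvd A"
      using assms(2) unfolding omega_def
      by (metis card.empty ex_in_conv in_prime_factors_iff)
    then have "\<not> X dvd p" using \<open>\<not> X dvd A\<close> dvd_trans by blast
    then have "X dvd 1 + p" by (simp add: linear_dvd_iff)
    with biunitary_perfect_one_plus_dvd[OF assms(1) p] \<open>\<not> X dvd A\<close> show False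
      using dvd_trans by blast
  qed
  show "X + 1 dvd A"
    using biunitary_perfect_one_plus_dvd[OF assms(1) prime_linear X] by (simp only: add.commute)
qed

theorem theorem1p1:
  fixes A :: "bit poly"
  assumes "biunitary_perfect A" and "omega A = 3"
  shows "A \<in> {C1, C2, C3, C4, C5, C6, C7} \<or> conj_poly A \<in> {C1, C2, C3, C4, C5, C6, C7}"
proof -
  have A0: "A \<noteq> 0" and sigA: "sigma_bu A = A" using assms(1) by (auto simp: biunitary_perfect_def)
  let ?Y = "X + 1"
  have Y: "?Y = [:1, 1:]" by (simp add: one_pCons)
  have primes: "prime X" "prime ?Y" unfolding Y by (rule prime_linear)+
  have XY: "X \<noteq> ?Y" by simp
  have "{X, ?Y} \<subseteq> prime_factors A"
    using biunitary_perfect_linear_factors[OF assms(1)] assms(2) primes A0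
    by (simp add: in_prime_factors_iff)
  then have "card (prime_factors A - {X, ?Y}) = 1"
    using assms(2) XY by (subst card_Diff_subset) (auto simp: omega_def)
  then obtain P where P: "prime_factors A - {X, ?Y} = {P}" by (rule card_1_singletonE)
  then have pf: "prime_factors A = {X, ?Y, P}" and ne: "X \<noteq> P" "?Y \<noteq> P"
    using \<open>{X, ?Y} \<subseteq> prime_factors A\<close> by auto
  have primeP: "prime P" and PA: "P dvd A" using pf by auto
  define a b c where "a = multiplicity X A" and "b = multiplicity ?Y A" and "c = multiplicity P A"
  have pos: "a > 0" "b > 0" "c > 0"
    unfolding a_def b_def c_def using pf unfolding prime_factors_multiplicity by blast+
  have A: "A = X ^ a * ?Y ^ b * P ^ c"
    using prod_prime_factors[OF A0] XY ne unfolding pf a_def b_def c_def normalize_bit_poly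
    by (simp add: mult.assoc)
  have cop: "coprime X ?Y" "coprime X P" "coprime ?Y P"
    using primes primeP XY ne by (auto intro: primes_coprime)
  have "sigma_bu A = sigma_bu (X ^ a * ?Y ^ b) * sigma_bu (P ^ c)"
    unfolding A using cop primes primeP by (intro sigma_bu_mult) auto
  also have "sigma_bu (X ^ a * ?Y ^ b) = sigma_bu (X ^ a) * sigma_bu (?Y ^ b)"
    using cop primes by (intro sigma_bu_mult) auto
  finally have eq: "A = sigma_bu (X ^ a) * sigma_bu (?Y ^ b) * sigma_bu (P ^ c)"
    unfolding sigA .
  have dvds: "sigma_bu ([:0, 1:] ^ a) dvd X ^ a * ?Y ^ b * P ^ c"
    "sigma_bu ([:1, 1:] ^ b) dvd X ^ a * ?Y ^ b * P ^ c"
    "sigma_bu (P ^ c) dvd X ^ a * ?Y ^ b * P ^ c"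
    unfolding A[symmetric] Y[symmetric] by (subst eq, simp)+
  have "\<not> P dvd 1 + P"
    using primeP by (metis dvd_add_left_iff dvd_refl not_prime_unit)
  then have "coprime (1 + P) (P ^ c)"
    using primeP by (simp add: prime_imp_coprime coprime_commute)
  moreover have "1 + P dvd X ^ a * ?Y ^ b * P ^ c"
    using biunitary_perfect_one_plus_dvd[OF assms(1) primeP PA] unfolding A .
  ultimately have P1: "1 + P dvd X ^ a * ?Y ^ b"
    by (simp add: coprime_dvd_mult_left_iff)
  have c: "c = 2 \<or> odd c" and sigP: "sigma_bu (P ^ c) = (1 + P) ^ c"
    using sigma_bu_mersenne_prime_power[OF primeP pos(3) dvds(3)] pos(3)
    by (auto simp: zero_less_diff)
  obtain da ea fa where da: "da \<in> {2, 4}" "linear_exps da (P = geo X (Suc da)) a ea fa"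
    and sigX: "sigma_bu (X ^ a) = (1 + X) ^ ea * P ^ fa"
    using linear_exps_of_sigma_bu[OF primeP pos(1) dvds(1) P1] by blast
  obtain db eb fb where db: "db \<in> {2, 4}" "linear_exps db (P = geo [:1, 1:] (Suc db)) b eb fb"
    and sigY: "sigma_bu (?Y ^ b) = (1 + ?Y) ^ eb * P ^ fb"
    using linear_exps_of_sigma_bu[OF primeP pos(2) dvds(2) P1] unfolding Y by blast
  have "1 + ?Y = X" by (simp add: one_pCons)
  then have eq': "X ^ a * ?Y ^ b * P ^ c = ?Y ^ ea * P ^ fa * (X ^ eb * P ^ fb) * (1 + P) ^ c"
    using eq unfolding sigP sigX sigY A by (simp only: add.commute)
  \<comment> \<open>The factorisation of \<open>1 + P\<close> differs from case to case, so its
    exponents \<open>g\<close> and \<open>h\<close> stay open here.\<close>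
  have exps: "a = eb + g * c \<and> b = ea + h * c \<and> c = fa + fb" if "1 + P = X ^ g * ?Y ^ h" for g h
  proof -
    have "X ^ a * ?Y ^ b * P ^ c = X ^ (eb + g * c) * ?Y ^ (ea + h * c) * P ^ (fa + fb)"
      unfolding eq' that by (simp only: power_mult_distrib power_add mult_ac flip: power_mult)
    from prime_powers_eq_imp[OF primes primeP XY ne this] show ?thesis .
  qed
  have conjA: "conj_poly A = ?Y ^ a * X ^ b * conj_poly P ^ c"
    unfolding A Y by (simp add: conj_poly_mult conj_poly_power conj_poly_linear)
  \<comment> \<open>The sums of length 3 for x and x + 1 both equal \<open>M1\<close>; those of
    length 5 are distinct conjugates. If \<open>P\<close> is none of these, neither linear factor
    contributes a power of \<open>P\<close>.\<close>
  consider "P = M1" | "P = geo X 5" | "P = geo [:1, 1:] 5" | "fa = 0" "fb = 0"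
    using da db by (auto simp: linear_exps_def geo_linear_explicit M1_explicit)
  then show ?thesis
  proof cases
    case 1
    have "da = 2 \<or> P \<noteq> geo X (Suc da)" "db = 2 \<or> P \<noteq> geo [:1, 1:] (Suc db)"
      unfolding 1 M1_explicit using da(1) db(1) by (auto simp: geo_linear_explicit)
    then have "linear_exps 2 True a ea fa" "linear_exps 2 True b eb fb"
      using linear_exps_mono[OF da(2)] linear_exps_mono[OF db(2)] by blast+
    from linear_exps_2_solutions[OF this pos(3) c] exps[of 1 1]
    have sol: "(a, b, c) \<in>
      {(3, 4, 1), (4, 3, 1), (3, 5, 2), (5, 3, 2), (4, 4, 2), (6, 6, 2), (4, 5, 3), (5, 4, 3)}"
      unfolding 1 one_plus_M1 by simp
    have "conj_poly M1 = M1"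
      using conj_poly_geo_linear[of 0 3] by (simp add: M1_explicit geo_linear_explicit)
    with sol show ?thesis
      unfolding conjA unfolding A 1 C1_def C2_def C3_def C4_def C5_def
      by (auto simp only: insert_iff empty_iff prod.inject mult_ac power_one_right simp_thms)
  next
    case 2
    have "P \<noteq> geo [:1, 1:] (Suc db)" "da = 4 \<or> P \<noteq> geo X (Suc da)"
      unfolding 2 using da(1) db(1) by (auto simp: geo_linear_explicit)
    then have "linear_exps 4 True a ea fa" "linear_exps 4 False b eb fb"
      using linear_exps_mono[OF da(2)] linear_exps_mono[OF db(2)] by blast+
    moreover from this have "eb = b" "fb = 0" by (auto simp: linear_exps_def)
    ultimately have sol: "(a, b, c) \<in> {(8, 7, 1), (9, 7, 2)}"
      using linear_exps_4_solutions[of a ea fa b c] pos(3) c exps[of 1 3]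
      unfolding 2 one_plus_geo_X_5 by simp
    \<comment> \<open>Here \<open>P\<close> is \<open>1 + x + x^2 + x^3 + x^4\<close>, so the
      conjugate of \<open>A\<close> is the listed polynomial; in the next case \<open>A\<close>
      itself is.\<close>
    have "conj_poly P = M5"
      unfolding 2 conj_poly_geo_linear by (simp add: M5_explicit geo_linear_explicit)
    with sol show ?thesis
      unfolding conjA C6_def C7_def
      by (auto simp only: insert_iff empty_iff prod.inject mult_ac power_one_right simp_thms)
  next
    case 3
    have "P \<noteq> geo X (Suc da)" "db = 4 \<or> P \<noteq> geo [:1, 1:] (Suc db)"
      unfolding 3 using da(1) db(1) by (auto simp: geo_linear_explicit)
    then have "linear_exps 4 True b eb fb" "linear_exps 4 False a ea fa"
      using linear_exps_mono[OF da(2)] linear_exps_mono[OF db(2)] by blast+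
    moreover from this have "ea = a" "fa = 0" by (auto simp: linear_exps_def)
    ultimately have sol: "(b, a, c) \<in> {(8, 7, 1), (9, 7, 2)}"
      using linear_exps_4_solutions[of b eb fb a c] pos(3) c exps[of 3 1]
      unfolding 3 one_plus_geo_X1_5 by simp
    have "P = M5"
      unfolding 3 by (simp add: M5_explicit geo_linear_explicit)
    with sol show ?thesis
      unfolding A C6_def C7_def
      by (auto simp only: insert_iff empty_iff prod.inject mult_ac power_one_right simp_thms)
  next
    case 4
    \<comment> \<open>\<open>P\<close> divides \<open>A\<close>, but the other side has only the
      primes x and x + 1 and the factor \<open>1 + P\<close>, none divisible by
      \<open>P\<close>.\<close>
    have "P dvd X ^ a * ?Y ^ b * P ^ c" using pos(3) by (simp add: dvd_mult dvd_power)
    then have "P dvd ?Y ^ ea * X ^ eb * (1 + P) ^ c"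
      unfolding eq' 4 by simp
    then have "P dvd ?Y \<or> P dvd X \<or> P dvd 1 + P"
      using primeP by (metis prime_dvd_mult_iff prime_dvd_power)
    then show ?thesis
      using \<open>\<not> P dvd 1 + P\<close> ne primes primeP by (metis primes_dvd_imp_eq)
  qed
qed

end
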